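(* If $\mathcal{E}$ is a tensorial ellipsoid in $\otimes_{i=1}^{l}\mathbb{R}^{d_{i}}$, then there exist linear isomorphisms $T_{i}:\mathbb{R}^{d_i}\rightarrow\mathbb{R}^{d_i}$, $i=1,\ldots,l$, such that $$\mathcal{E}=T_{1}\otimes\cdots\otimes T_{l}\left(B_2^{d_1,\ldots,d_l}\right)=T_{1}\left(B_{2}^{d_{1}}\right)\otimes_2\cdots\otimes_{2}T_{l}\left(B_{2}^{d_{l}}\right).$$
   Context: Here $l$ and $d_1,\dots,d_l$ are positive integers. $\langle\cdot,\cdot\rangle$ is the standard scalar product on $\mathbb{R}^{d}$ with closed unit ball $B_2^d$, and $\langle\cdot,\cdot\rangle_H$ is the scalar product on $\otimes_{i=1}^l\mathbb{R}^{d_i}$ determined by $\langle x^1\otimes\cdots\otimes x^l,y^1\otimes\cdots\otimes y^l\rangle_H=\prod_{i=1}^l\langle x^i,y^i\rangle$, with closed unit ball $B_2^{d_1,\ldots,d_l}$. A $0$-symmetric convex body is a compact convex set $P$ with nonempty interior and $P=-P$. The polar set of a nonempty $C$ in a Euclidean space $\mathbb{E}$ is $C^\circ=\{y\in\mathbb{E}:\sup_{x\in C}|\langle x,y\rangle_{\mathbb{E}}|\le 1\}$ (with $\langle\cdot,\cdot\rangle$ in $\mathbb{R}^{d_i}$ and $\langle\cdot,\cdot\rangle_H$ in the tensor product). For $0$-symmetric convex bodies $Q_i\subset\mathbb{R}^{d_i}$: $Q_1\otimes_\pi\cdots\otimes_\pi Q_l:=\mathrm{conv}\{x^1\otimes\cdots\otimes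 x^l:x^i\in Q_i,\ i=1,\dots,l\}$ and $Q_1\otimes_\epsilon\cdots\otimes_\epsilon Q_l:=(Q_1^\circ\otimes_\pi\cdots\otimes_\pi Q_l^\circ)^\circ$. A $0$-symmetric convex body $Q\subset\otimes_{i=1}^l\mathbb{R}^{d_i}$ is a tensorial body if there exist $0$-symmetric convex bodies $Q_i\subset\mathbb{R}^{d_i}$ with $Q_{1}\otimes_{\pi}\cdots\otimes_{\pi}Q_{l}\subseteq Q\subseteq Q_{1}\otimes_{\epsilon}\cdots\otimes_{\epsilon}Q_{l}$. An ellipsoid in $\otimes_{i=1}^l\mathbb{R}^{d_i}$ is a set $T(B_2^{d_1,\ldots,d_l})$ with $T$ a linear isomorphism of $\otimes_{i=1}^l\mathbb{R}^{d_i}$; a tensorial ellipsoid is an ellipsoid that is also a tensorial body in $\otimes_{i=1}^l\mathbb{R}^{d_i}$. For ellipsoids $\mathcal{E}_i=T_i(B_2^{d_i})\subset\mathbb{R}^{d_i}$ ($T_i$ linear isomorphisms), their Hilbertian tensor product is $\mathcal{E}_1\otimes_2\cdots\otimes_2\mathcal{E}_l:=T_1\otimes\cdots\otimes T_l(B_2^{d_1,\ldots,d_l})$. *)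

theory Defs
  imports "HOL-Analysis.Analysis"
begin

text \<open>
  The dimensions \<open>d\<^sub>i\<close> of the factors differ, so the spaces \<open>\<real>\<^bsup>d\<^sub>i\<^esup>\<close> cannot all be one
  type \<open>real ^ 'n\<close>. Instead the factor \<open>\<real>\<^bsup>d\<^sub>i\<^esup>\<close> is the space \<open>\<real>\<^bsup>K i\<^esup>\<close> of vectors with
  coordinates in an index set \<open>K i\<close> of cardinality \<open>d\<^sub>i\<close>, realised as a coordinate subspace
  of \<open>real ^ 'n\<close> for a sufficiently large \<open>'n\<close>. The factors are indexed by a finite type
  \<open>'l\<close> (so \<open>l = CARD('l)\<close>). The tensor product of the \<open>\<real>\<^bsup>K i\<^esup>\<close> is the space of arrays with
  coordinates in the product of the \<open>K i\<close>, a coordinate subspace of \<open>real ^ ('l \<Rightarrow> 'n)\<close>.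
  The notions for a Euclidean space take this ambient subspace \<open>V\<close> as an argument.
\<close>

definition coord_space :: "'n::finite set \<Rightarrow> (real ^ 'n) set" where
  "coord_space S = {x. \<forall>k. k \<notin> S \<longrightarrow> x $ k = 0}"

definition unit_ball :: "'a::euclidean_space set \<Rightarrow> 'a set" where
  "unit_ball V = {x \<in> V. norm x \<le> 1}"

text \<open>The interior is taken in the space \<open>V\<close>, not in the surrounding type.\<close>

definition symmetric_convex_body :: "'a::euclidean_space set \<Rightarrow> 'a set \<Rightarrow> bool" where
  "symmetric_convex_body V P \<longleftrightarrow>
     P \<subseteq> V \<and> compact P \<and> convex P \<and> (top_of_set V) interior_of P \<noteq> {} \<and> P = uminus ` P"

definition polar_set :: "'a::euclidean_space set \<Rightarrow> 'a set \<Rightarrow> 'a set" where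
  "polar_set V C = {y \<in> V. \<forall>x\<in>C. \<bar>x \<bullet> y\<bar> \<le> 1}"

text \<open>
  Isomorphisms of \<open>V\<close> are given by linear maps on the surrounding type; only their values on
  \<open>V\<close> matter below, and every linear map on a subspace has such an extension.
\<close>

definition linear_iso :: "'a::euclidean_space set \<Rightarrow> ('a \<Rightarrow> 'a) \<Rightarrow> bool" where
  "linear_iso V T \<longleftrightarrow> linear T \<and> bij_betw T V V"

definition ellipsoid :: "'a::euclidean_space set \<Rightarrow> 'a set \<Rightarrow> bool" where
  "ellipsoid V E \<longleftrightarrow> (\<exists>T. linear_iso V T \<and> E = T ` unit_ball V)"

definition tensor_space :: "('l::finite \<Rightarrow> 'n::finite set) \<Rightarrow> (real ^ ('l \<Rightarrow> 'n)) set" where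
  "tensor_space K = coord_space {m. \<forall>i. m i \<in> K i}"

definition tensor_vec :: "('l::finite \<Rightarrow> real ^ 'n::finite) \<Rightarrow> real ^ ('l \<Rightarrow> 'n)" where
  "tensor_vec x = (\<chi> m. \<Prod>i\<in>UNIV. x i $ m i)"

text \<open>\<open>T\<^sub>1 \<otimes> \<dots> \<otimes> T\<^sub>l\<close>, defined on the standard basis tensors and extended linearly.\<close>

definition tensor_map ::
    "('l::finite \<Rightarrow> real ^ 'n::finite \<Rightarrow> real ^ 'n) \<Rightarrow> real ^ ('l \<Rightarrow> 'n) \<Rightarrow> real ^ ('l \<Rightarrow> 'n)" where
  "tensor_map T z = (\<Sum>m\<in>UNIV. z $ m *\<^sub>R tensor_vec (\<lambda>i. T i (axis (m i) 1)))"

definition pi_tensor :: "('l::finite \<Rightarrow> (real ^ 'n::finite) set) \<Rightarrow> (real ^ ('l \<Rightarrow> 'n)) set" where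
  "pi_tensor Q = convex hull {tensor_vec x |x. \<forall>i. x i \<in> Q i}"

definition eps_tensor ::
    "('l::finite \<Rightarrow> 'n::finite set) \<Rightarrow> ('l \<Rightarrow> (real ^ 'n) set) \<Rightarrow> (real ^ ('l \<Rightarrow> 'n)) set" where
  "eps_tensor K Q =
     polar_set (tensor_space K) (pi_tensor (\<lambda>i. polar_set (coord_space (K i)) (Q i)))"

definition tensorial_body ::
    "('l::finite \<Rightarrow> 'n::finite set) \<Rightarrow> (real ^ ('l \<Rightarrow> 'n)) set \<Rightarrow> bool" where
  "tensorial_body K P \<longleftrightarrow> symmetric_convex_body (tensor_space K) P \<and>
     (\<exists>Q. (\<forall>i. symmetric_convex_body (coord_space (K i)) (Q i)) \<and>
          pi_tensor Q \<subseteq> P \<and> P \<subseteq> eps_tensor K Q)"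

definition tensorial_ellipsoid ::
    "('l::finite \<Rightarrow> 'n::finite set) \<Rightarrow> (real ^ ('l \<Rightarrow> 'n)) set \<Rightarrow> bool" where
  "tensorial_ellipsoid K E \<longleftrightarrow> ellipsoid (tensor_space K) E \<and> tensorial_body K E"

text \<open>
  The Hilbertian tensor product of ellipsoids: the value \<open>(T\<^sub>1 \<otimes> \<dots> \<otimes> T\<^sub>l)(B)\<close> common to all
  choices of isomorphisms \<open>T\<^sub>i\<close> with \<open>E\<^sub>i = T\<^sub>i(B\<^sub>i)\<close>. (The \<open>T\<^sub>i\<close> are determined by \<open>E\<^sub>i\<close>
  up to orthogonal maps, so the value does not depend on them.)
\<close>

definition hilbert_tensor ::
    "('l::finite \<Rightarrow> 'n::finite set) \<Rightarrow> ('l \<Rightarrow> (real ^ 'n) set) \<Rightarrow> (real ^ ('l \<Rightarrow> 'n)) set" where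
  "hilbert_tensor K E = (THE S. \<exists>T.
     (\<forall>i. linear_iso (coord_space (K i)) (T i) \<and> E i = T i ` unit_ball (coord_space (K i))) \<and>
     S = tensor_map T ` unit_ball (tensor_space K))"

text \<open>
  The following facts confirm that these coordinates present the tensor product, that the
  standard inner product is \<open>\<langle>\<cdot>,\<cdot>\<rangle>\<^sub>H\<close>, and that \<^const>\<open>tensor_map\<close> is the tensor product of maps.
\<close>

lemma dim_coord_space: "dim (coord_space S) = card S"
proof -
  have "coord_space S = {x. \<forall>i\<in>Basis. i \<notin> (\<lambda>k. axis k 1) ` S \<longrightarrow> x \<bullet> i = 0}"
    by (auto simp: coord_space_def Basis_vec_def inner_axis axis_eq_axis image_iff)
  moreover have "(\<lambda>k. axis k 1) ` S \<subseteq> (Basis :: (real ^ 'a) set)"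
    by (auto simp: Basis_vec_def)
  ultimately have "dim (coord_space S) = card ((\<lambda>k. axis k 1 :: real ^ 'a) ` S)"
    by (simp add: dim_substandard)
  also have "\<dots> = card S"
    by (intro card_image inj_onI) (simp add: axis_eq_axis)
  finally show ?thesis .
qed

lemma sum_prod_multiindex:
  fixes f :: "'l::finite \<Rightarrow> 'n::finite \<Rightarrow> real"
  shows "(\<Sum>m\<in>UNIV. \<Prod>i\<in>UNIV. f i (m i)) = (\<Prod>i\<in>UNIV. \<Sum>k\<in>UNIV. f i k)"
  using prod_sum_PiE[of "UNIV :: 'l set" "\<lambda>_. UNIV :: 'n set" f] by simp

lemma inner_tensor_vec: "tensor_vec x \<bullet> tensor_vec y = (\<Prod>i\<in>UNIV. x i \<bullet> y i)"
  by (simp add: tensor_vec_def inner_vec_def prod.distrib flip: sum_prod_multiindex)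

lemma tensor_vec_axis: "tensor_vec (\<lambda>i. axis (m i) 1) = axis m 1"
proof -
  have "(\<Prod>i\<in>UNIV. axis (m i) (1::real) $ m' i) = axis m 1 $ m'" for m'
  proof (cases "m' = m")
    case False
    then obtain i where "m' i \<noteq> m i" by blast
    then show ?thesis
      using False by (auto simp: axis_def intro!: bexI[of _ i])
  qed (simp add: axis_def)
  then show ?thesis by (simp add: tensor_vec_def vec_eq_iff)
qed

lemma linear_tensor_map: "linear (tensor_map T)"
  by (intro linearI)
    (simp_all add: tensor_map_def scaleR_add_left sum.distrib scaleR_sum_right)

lemma tensor_map_tensor_vec:
  assumes "\<And>i. linear (T i)"
  shows "tensor_map T (tensor_vec x) = tensor_vec (\<lambda>i. T i (x i))"
proof -
  have T: "T i (x i) = (\<Sum>k\<in>UNIV. x i $ k *\<^sub>R T i (axis k 1))" for i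
  proof -
    have "T i (x i) = T i (\<Sum>k\<in>UNIV. x i $ k *\<^sub>R axis k 1)"
      using basis_expansion[of "x i"] by (simp add: scalar_mult_eq_scaleR)
    also have "\<dots> = (\<Sum>k\<in>UNIV. x i $ k *\<^sub>R T i (axis k 1))"
      using assms[of i] by (simp add: linear_sum linear_scale)
    finally show ?thesis .
  qed
  have "tensor_map T (tensor_vec x) $ n = tensor_vec (\<lambda>i. T i (x i)) $ n" for n
  proof -
    have "tensor_map T (tensor_vec x) $ n
        = (\<Sum>m\<in>UNIV. \<Prod>i\<in>UNIV. x i $ m i * T i (axis (m i) 1) $ n i)"
      by (simp add: tensor_map_def tensor_vec_def prod.distrib)
    also have "\<dots> = (\<Prod>i\<in>UNIV. \<Sum>k\<in>UNIV. x i $ k * T i (axis k 1) $ n i)"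
      by (rule sum_prod_multiindex)
    also have "\<dots> = tensor_vec (\<lambda>i. T i (x i)) $ n"
      by (subst T) (simp add: tensor_vec_def)
    finally show ?thesis .
  qed
  then show ?thesis by (simp add: vec_eq_iff)
qed

lemma span_tensor_vec:
  "span {tensor_vec x |x. \<forall>i. x i \<in> coord_space (K i)} = tensor_space K" (is "span ?A = _")
proof
  have "subspace (tensor_space K)"
    by (simp add: tensor_space_def coord_space_def subspace_def)
  moreover have "?A \<subseteq> tensor_space K"
    unfolding tensor_space_def coord_space_def tensor_vec_def by fastforce
  ultimately show "span ?A \<subseteq> tensor_space K"
    by (rule span_minimal[rotated])
next
  show "tensor_space K \<subseteq> span ?A"
  proof
    fix z assume z: "z \<in> tensor_space K"
    have "z $ m *\<^sub>R axis m 1 \<in> span ?A" for m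
    proof (cases "\<forall>i. m i \<in> K i")
      case True
      then have "\<forall>i. axis (m i) 1 \<in> coord_space (K i)"
        by (auto simp: coord_space_def axis_def)
      then have "tensor_vec (\<lambda>i. axis (m i) 1) \<in> ?A" by blast
      then show ?thesis by (simp add: tensor_vec_axis span_base span_scale)
    next
      case False
      then have "z $ m = 0" using z by (auto simp: tensor_space_def coord_space_def)
      then show ?thesis by (simp add: span_zero)
    qed
    then have "(\<Sum>m\<in>UNIV. z $ m *\<^sub>R axis m 1) \<in> span ?A" by (intro span_sum)
    then show "z \<in> span ?A"
      using basis_expansion[of z] by (simp add: scalar_mult_eq_scaleR)
  qed
qed

end

theory Submission
  imports Defs
begin

text \<open>
  Let \<open>E\<close> be an ellipsoid with \<open>\<pi>(Q) \<subseteq> E \<subseteq> \<epsilon>(Q)\<close>, where \<open>\<pi>(Q)\<close> and \<open>\<epsilon>(Q)\<close> denote the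
  projective and the injective tensor product of bodies \<open>Q i\<close>.

  The bodies \<open>Q i\<close> are ellipsoids (lemma \<open>factor_is_ellipsoid\<close>). Choose
  \<open>x j \<in> Q j\<close> and \<open>y j \<in> (Q j)\<degree>\<close> with \<open>x j \<bullet> y j = 1\<close> and let \<open>\<phi> v\<close> be the elementary tensor
  with \<open>v\<close> in place \<open>i\<close> and \<open>x j\<close> in the other places. The first inclusion gives
  \<open>\<phi> v \<in> E\<close> for \<open>v \<in> Q i\<close>. If \<open>\<phi> v \<in> E\<close>, then pairing with the tensor of \<open>w \<in> (Q i)\<degree>\<close> and the
  \<open>y j\<close> gives \<open>\<bar>v \<bullet> w\<bar> \<le> 1\<close> by the second inclusion, so \<open>v \<in> Q i\<close> by the bipolar theorem.
  Thus \<open>Q i\<close> is the preimage of \<open>E\<close> under an injective linear map, hence the image \<open>T i (B i)\<close>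
  of the unit ball \<open>B i\<close> of the \<open>i\<close>-th factor.

  In the coordinates given by the \<open>T i\<close> we have \<open>Q i = B i\<close> and \<open>E = U(B)\<close> with \<open>U\<close> linear
  (lemma \<open>ellipsoid_between_unique\<close>). For an elementary tensor \<open>u\<close> of unit vectors the two
  inclusions say \<open>\<parallel>U\<inverse> u\<parallel> \<le> 1\<close> and \<open>\<parallel>U\<^sup>T u\<parallel> \<le> 1\<close>. As \<open>\<langle>U\<inverse> u, U\<^sup>T u\<rangle> = \<langle>u, u\<rangle> = 1\<close>, the equality
  case of the Cauchy-Schwarz inequality gives \<open>U\<inverse> u = U\<^sup>T u\<close>. Such \<open>u\<close> span the tensor space,
  so \<open>U\<close> is orthogonal and \<open>U(B) = B\<close>.

  Conversely, the Hilbertian tensor product of the ellipsoids \<open>T i (B i)\<close> lies between their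
  projective and their injective tensor product (lemma \<open>hilbert_between_pi_eps\<close>). By the
  uniqueness just proved it depends only on the sets \<open>T i (B i)\<close>, so the definite description
  that defines it is proper.
\<close>

section \<open>Linear algebra in a subspace\<close>

lemma linear_iso_inverse:
  assumes "linear_iso V T" and "subspace V"
  obtains T' where "linear_iso V T'" and "\<And>x. x \<in> V \<Longrightarrow> T' (T x) = x"
    and "\<And>x. x \<in> V \<Longrightarrow> T (T' x) = x"
proof -
  have T: "linear T" "inj_on T V" "T ` V = V"
    using assms(1) by (auto simp: linear_iso_def bij_betw_def)
  obtain T' where T': "linear T'" "\<And>x. x \<in> V \<Longrightarrow> T' (T x) = x"
    using linear_exists_left_inverse_on[OF T(1) assms(2) T(2)] by blast
  have TT': "T (T' x) = x" if "x \<in> V" for x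
    using that T(3) T'(2) by (metis imageE)
  have "T' x \<in> V" if "x \<in> V" for x
    using that T(3) T'(2) by (metis imageE)
  then have "bij_betw T' V V"
    using T T'(2) TT' by (intro bij_betw_byWitness[where f' = T]) auto
  then show ?thesis
    using that T' TT' by (auto simp: linear_iso_def)
qed

lemma riesz_subspace:
  fixes f :: "'a::euclidean_space \<Rightarrow> real"
  assumes "linear f" and "subspace V"
  obtains c where "c \<in> V" and "\<And>v. v \<in> V \<Longrightarrow> f v = v \<bullet> c"
proof -
  have f: "f v = v \<bullet> adjoint f 1" for v
    using adjoint_works[OF assms(1), of v 1] by simp
  obtain c d where cd: "c \<in> span V" "\<And>w. w \<in> span V \<Longrightarrow> orthogonal d w" "adjoint f 1 = c + d"
    using orthogonal_subspace_decomp_exists[of V "adjoint f 1"] by blast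
  have "f v = v \<bullet> c" if "v \<in> V" for v
    using f[of v] cd(2)[of v] cd(3) that
    by (simp add: span_base orthogonal_def inner_commute inner_add_right)
  moreover have "c \<in> V"
    using cd(1) assms(2) span_eq_iff by blast
  ultimately show ?thesis using that by blast
qed

text \<open>
  A pointwise substitute for the adjoint of \<open>f\<close> restricted to \<open>V\<close>: the adjoint on the whole
  type need not map into \<open>V\<close>.
\<close>

lemma transpose_subspace:
  fixes f :: "'a::euclidean_space \<Rightarrow> 'a"
  assumes "linear f" and "subspace V"
  obtains y where "y \<in> V" and "\<And>v. v \<in> V \<Longrightarrow> f v \<bullet> x = v \<bullet> y"
proof -
  have "linear (\<lambda>v. f v \<bullet> x)"
    using assms(1) by (intro linearI) (simp_all add: linear_add linear_scale inner_add_left)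
  then show ?thesis using riesz_subspace assms(2) that by blast
qed

lemma in_unit_ball_normalize:
  assumes "subspace V" and "c \<in> V"
  shows "(1 / norm c) *\<^sub>R c \<in> unit_ball V"
  using assms by (simp add: unit_ball_def subspace_scale)

text \<open>
  The functional is \<open>\<lambda>z. z \<bullet> c\<close> with \<open>norm c \<le> 1\<close>, and \<open>b \<bullet> c = 1\<close> is then the equality
  case of the Cauchy-Schwarz inequality, which forces \<open>c = b\<close>.
\<close>

lemma functional_attaining_norm:
  fixes f :: "'a::euclidean_space \<Rightarrow> real"
  assumes "linear f" and "subspace V"
    and bound: "\<And>z. z \<in> unit_ball V \<Longrightarrow> \<bar>f z\<bar> \<le> 1"
    and b: "b \<in> unit_ball V" "f b = 1"
    and z: "z \<in> V"
  shows "f z = z \<bullet> b"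
proof -
  obtain c where c: "c \<in> V" "\<And>v. v \<in> V \<Longrightarrow> f v = v \<bullet> c"
    using riesz_subspace[OF assms(1,2)] by blast
  have "norm c \<le> 1"
  proof (cases "c = 0")
    case False
    have n: "(1 / norm c) *\<^sub>R c \<in> unit_ball V"
      using in_unit_ball_normalize[OF assms(2) c(1)] .
    then have "f ((1 / norm c) *\<^sub>R c) = norm c"
      using c(2) False by (simp add: unit_ball_def dot_square_norm power2_eq_square)
    then show ?thesis using bound[OF n] by simp
  qed simp
  then have "c \<bullet> c \<le> 1" by (simp add: dot_square_norm power_le_one)
  moreover have "b \<bullet> b \<le> 1" "b \<bullet> c = 1"
    using b c(2) by (auto simp: unit_ball_def dot_square_norm power_le_one)
  moreover have "(c - b) \<bullet> (c - b) = c \<bullet> c - 2 * (b \<bullet> c) + b \<bullet> b"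
    by (simp add: inner_diff_left inner_diff_right inner_commute)
  ultimately have "(c - b) \<bullet> (c - b) \<le> 0" by simp
  then have "c = b" using inner_ge_zero[of "c - b"] by (metis antisym inner_eq_zero_iff eq_iff_diff_eq_0)
  then show ?thesis using c(2) z by simp
qed

lemma isometry_unit_ball:
  assumes "linear_iso V U" and "\<And>z. z \<in> V \<Longrightarrow> norm (U z) = norm z"
  shows "U ` unit_ball V = unit_ball V"
proof
  show "U ` unit_ball V \<subseteq> unit_ball V"
    using assms by (auto simp: unit_ball_def linear_iso_def bij_betw_def)
  show "unit_ball V \<subseteq> U ` unit_ball V"
  proof
    fix w assume w: "w \<in> unit_ball V"
    then have "w \<in> U ` V" using assms(1) by (simp add: unit_ball_def linear_iso_def bij_betw_def)
    then obtain z where "z \<in> V" "U z = w" by blast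
    then show "w \<in> U ` unit_ball V" using w assms(2) by (auto simp: unit_ball_def)
  qed
qed

lemma convex_unit_ball:
  assumes "subspace V"
  shows "convex (unit_ball V)"
proof -
  have "unit_ball V = V \<inter> cball 0 1" by (auto simp: unit_ball_def)
  then show ?thesis using assms by (simp add: convex_Int subspace_imp_convex)
qed

text \<open>The pulled-back norm \<open>\<lambda>v. norm (L v)\<close> is isometric to the Euclidean norm of \<open>V\<close>, because
  \<open>L ` V\<close> is a Euclidean space of the same dimension as \<open>V\<close>.\<close>

lemma ellipsoid_preimage_ball:
  fixes L :: "'a::euclidean_space \<Rightarrow> 'b::euclidean_space"
  assumes "linear L" and "subspace V" and inj: "inj_on L V"
  shows "ellipsoid V {v \<in> V. norm (L v) \<le> 1}"
proof -
  obtain L' where L': "linear L'" "\<And>v. v \<in> V \<Longrightarrow> L' (L v) = v"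
    using linear_exists_left_inverse_on[OF assms] by blast
  have sub: "subspace (L ` V)"
    using assms by (simp add: linear_subspace_image)
  have "dim V = dim (L ` V)"
    using assms by (metis dim_image_eq span_eq_iff)
  then obtain g h where g: "linear g" "linear h" "g ` V = L ` V" "h ` L ` V = V"
      "\<And>x. x \<in> V \<Longrightarrow> norm (g x) = norm x" "\<And>x. x \<in> V \<Longrightarrow> h (g x) = x"
    using isometries_subspaces[OF assms(2) sub] by metis
  have LL': "L (L' (g x)) = g x" "L' (g x) \<in> V" if "x \<in> V" for x
    using that g(3) L'(2) by (metis (no_types, lifting) imageE imageI)+
  have gh: "g (h w) = w" if "w \<in> L ` V" for w
    using that g(3,6) by (metis imageE)
  have hL: "h (L v) \<in> V" if "v \<in> V" for v
    using that g(4) by blast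
  define T where "T = L' \<circ> g"
  have "bij_betw T V V"
    by (rule bij_betw_byWitness[where f' = "h \<circ> L"])
      (use LL' hL gh L'(2) g(6) in \<open>auto simp: T_def\<close>)
  then have iso: "linear_iso V T"
    using g(1) L'(1) by (simp add: linear_iso_def T_def linear_compose)
  have "{v \<in> V. norm (L v) \<le> 1} = T ` unit_ball V"
  proof
    show "T ` unit_ball V \<subseteq> {v \<in> V. norm (L v) \<le> 1}"
      using LL' g(5) by (auto simp: T_def unit_ball_def)
    show "{v \<in> V. norm (L v) \<le> 1} \<subseteq> T ` unit_ball V"
    proof
      fix v assume v: "v \<in> {v \<in> V. norm (L v) \<le> 1}"
      then have "g (h (L v)) = L v" "h (L v) \<in> V" using gh hL by auto
      then have "h (L v) \<in> unit_ball V" "T (h (L v)) = v"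
        using v g(5)[of "h (L v)"] L'(2) by (auto simp: T_def unit_ball_def)
      then show "v \<in> T ` unit_ball V" by (metis imageI)
    qed
  qed
  then show ?thesis using iso by (auto simp: ellipsoid_def)
qed

section \<open>Symmetric convex bodies and polarity\<close>

lemma symmetric_convex_body_uminus:
  "symmetric_convex_body V Q \<Longrightarrow> x \<in> Q \<Longrightarrow> - x \<in> Q"
  unfolding symmetric_convex_body_def by (metis imageI)

lemma symmetric_convex_body_zero:
  assumes "symmetric_convex_body V Q"
  shows "0 \<in> Q"
proof -
  obtain p where p: "p \<in> Q"
    using assms interior_of_subset unfolding symmetric_convex_body_def by fastforce
  have "(1/2) *\<^sub>R p + (1/2) *\<^sub>R (- p) \<in> Q"
    using assms p symmetric_convex_body_uminus[OF assms p]
    by (intro convexD) (auto simp: symmetric_convex_body_def)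
  then show ?thesis by simp
qed

lemma symmetric_convex_body_nonzero:
  assumes Q: "symmetric_convex_body V Q" and V: "subspace V" and e: "e \<in> V" "e \<noteq> 0"
  obtains x where "x \<in> Q" and "x \<noteq> 0"
proof -
  obtain p where p: "p \<in> (top_of_set V) interior_of Q"
    using Q unfolding symmetric_convex_body_def by blast
  then obtain U where U: "openin (top_of_set V) U" "p \<in> U" "U \<subseteq> Q"
    by (auto simp: interior_of_def)
  then obtain r where r: "r > 0" "p \<in> V" "ball p r \<inter> V \<subseteq> Q"
    by (metis openin_contains_ball openin_subset topspace_euclidean_subtopology subsetD subset_trans)
  define x where "x = p + (r / (2 * norm e)) *\<^sub>R e"
  have "x \<in> ball p r \<inter> V"
    using r V e by (auto simp: x_def dist_norm subspace_add subspace_scale)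
  then have "x \<in> Q" "p \<in> Q" using r U by auto
  moreover have "x \<noteq> p" using r e by (simp add: x_def)
  ultimately show ?thesis using that by (cases "p = 0") auto
qed

text \<open>A point of \<open>Q\<close> of largest norm lies on a sphere that contains \<open>Q\<close>, and the hyperplane
  that touches the sphere there also supports \<open>Q\<close>.\<close>

lemma ex_dual_pair:
  assumes Q: "symmetric_convex_body V Q" and V: "subspace V" and e: "e \<in> V" "e \<noteq> 0"
  obtains x y where "x \<in> Q" and "y \<in> polar_set V Q" and "x \<bullet> y = 1"
proof -
  obtain x0 where x0: "x0 \<in> Q" "x0 \<noteq> 0"
    using symmetric_convex_body_nonzero[OF assms] .
  have "compact Q" using Q by (simp add: symmetric_convex_body_def)
  then obtain x where x: "x \<in> Q" "\<And>z. z \<in> Q \<Longrightarrow> norm z \<le> norm x"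
    using continuous_attains_sup[of Q norm] x0 continuous_on_norm_id by blast
  have pos: "norm x > 0" using x(2)[OF x0(1)] x0(2) by auto
  define y where "y = (1 / (norm x)\<^sup>2) *\<^sub>R x"
  have "\<bar>z \<bullet> y\<bar> \<le> 1" if "z \<in> Q" for z
  proof -
    have "\<bar>z \<bullet> x\<bar> \<le> norm z * norm x" by (rule Cauchy_Schwarz_ineq2)
    also have "\<dots> \<le> (norm x)\<^sup>2" using x(2)[OF that] by (simp add: power2_eq_square mult_right_mono)
    finally show ?thesis using pos by (simp add: y_def abs_mult)
  qed
  moreover have "y \<in> V" using x(1) Q V by (auto simp: y_def symmetric_convex_body_def subspace_scale)
  ultimately have "y \<in> polar_set V Q" by (simp add: polar_set_def)
  moreover have "x \<bullet> y = 1" using pos by (simp add: y_def dot_square_norm)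
  ultimately show ?thesis using that x(1) by blast
qed

text \<open>The nontrivial half of the bipolar theorem. The separating functional is \<open>v - p\<close> with
  \<open>p\<close> the point of \<open>Q\<close> closest to \<open>v\<close>; this vector lies in \<open>V\<close>.\<close>

lemma bipolar_subset:
  assumes Q: "symmetric_convex_body V Q" and V: "subspace V" and v: "v \<in> V"
    and bound: "\<And>y. y \<in> polar_set V Q \<Longrightarrow> \<bar>v \<bullet> y\<bar> \<le> 1"
  shows "v \<in> Q"
proof (rule ccontr)
  assume "v \<notin> Q"
  have props: "Q \<subseteq> V" "convex Q" "closed Q" "0 \<in> Q"
    using Q symmetric_convex_body_zero[OF Q]
    by (auto simp: symmetric_convex_body_def compact_imp_closed)
  obtain p where p: "p \<in> Q" "\<And>z. z \<in> Q \<Longrightarrow> dist v p \<le> dist v z"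
    using distance_attains_inf[OF props(3), of v] props(4) by blast
  define a where "a = v - p"
  define c where "c = a \<bullet> p"
  have le: "a \<bullet> z \<le> c" if "z \<in> Q" for z
    using any_closest_point_dot[OF props(2,3) p(1) that, of v] p(2)
    by (simp add: a_def c_def inner_diff_right)
  have abs_le: "\<bar>a \<bullet> z\<bar> \<le> c" if "z \<in> Q" for z
    using le[OF that] le[OF symmetric_convex_body_uminus[OF Q that]] by simp
  have "c \<ge> 0" using le[OF props(4)] by simp
  have "a \<bullet> a > 0" using \<open>v \<notin> Q\<close> p(1) by (auto simp: a_def)
  have av: "a \<bullet> v = c + a \<bullet> a" by (simp add: a_def c_def inner_diff_right)
  \<comment> \<open>The scaling puts the level 1 strictly between \<open>c\<close> and \<open>a \<bullet> v\<close>, also when \<open>c = 0\<close>.\<close>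
  define t where "t = 2 / (2 * c + a \<bullet> a)"
  have "2 * c + a \<bullet> a > 0" using \<open>c \<ge> 0\<close> \<open>a \<bullet> a > 0\<close> by linarith
  then have t: "t > 0" "t * c \<le> 1" "t * (a \<bullet> v) > 1"
    unfolding t_def av using \<open>c \<ge> 0\<close> \<open>a \<bullet> a > 0\<close>
    by (simp_all only: zero_less_divide_iff times_divide_eq_left divide_le_eq_1_pos less_divide_eq_1_pos) auto
  have "\<bar>z \<bullet> (t *\<^sub>R a)\<bar> \<le> 1" if "z \<in> Q" for z
  proof -
    have "\<bar>z \<bullet> (t *\<^sub>R a)\<bar> = t * \<bar>a \<bullet> z\<bar>" using t by (simp add: abs_mult inner_commute)
    also have "\<dots> \<le> t * c" using abs_le[OF that] t by simp
    finally show ?thesis using t by simp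
  qed
  moreover have "t *\<^sub>R a \<in> V"
    using p(1) props(1) v V by (auto simp: a_def subspace_scale subspace_diff)
  ultimately have "t *\<^sub>R a \<in> polar_set V Q" by (simp add: polar_set_def)
  then show False using bound[of "t *\<^sub>R a"] t(3) by (simp add: inner_commute)
qed

section \<open>Tensor spaces\<close>

lemma subspace_coord_space: "subspace (coord_space S)"
  by (simp add: coord_space_def subspace_def)

lemma subspace_tensor_space: "subspace (tensor_space K)"
  by (simp add: tensor_space_def subspace_coord_space)

lemma tensor_vec_in_tensor_space:
  assumes "\<And>i. x i \<in> coord_space (K i)"
  shows "tensor_vec x \<in> tensor_space K"
  unfolding span_tensor_vec[symmetric] using assms by (intro span_base) blast

text \<open>Elementary tensors span the tensor space, so identities that are linear in a tensor need
  only be checked on them.\<close>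

lemma linear_eq_on_tensor_space:
  assumes "linear f" and "linear g" and "z \<in> tensor_space K"
    and "\<And>x. (\<And>i. x i \<in> coord_space (K i)) \<Longrightarrow> f (tensor_vec x) = g (tensor_vec x)"
  shows "f z = g z"
  using assms(3) linear_eq_on[OF assms(1,2)] assms(4)
  unfolding span_tensor_vec[symmetric] by blast

lemma tensor_vec_scaleR:
  "tensor_vec (\<lambda>i. c i *\<^sub>R x i) = (\<Prod>i\<in>UNIV. c i) *\<^sub>R tensor_vec x"
  by (simp add: tensor_vec_def vec_eq_iff prod.distrib)

lemma linear_tensor_vec_upd: "linear (\<lambda>v. tensor_vec (x(i := v)))"
proof -
  have "tensor_vec (x(i := v)) $ m = v $ m i * (\<Prod>j\<in>UNIV - {i}. x j $ m j)" for v m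
  proof -
    have "tensor_vec (x(i := v)) $ m
        = v $ m i * (\<Prod>j\<in>UNIV - {i}. (x(i := v)) j $ m j)"
      by (simp add: tensor_vec_def prod.remove[of UNIV i])
    also have "(\<Prod>j\<in>UNIV - {i}. (x(i := v)) j $ m j) = (\<Prod>j\<in>UNIV - {i}. x j $ m j)"
      by (rule prod.cong) auto
    finally show ?thesis .
  qed
  then show ?thesis by (intro linearI) (simp_all add: vec_eq_iff algebra_simps)
qed

lemma inner_tensor_vec_upd:
  assumes "\<And>j. x j \<bullet> y j = 1"
  shows "tensor_vec (x(i := v)) \<bullet> tensor_vec (y(i := w)) = v \<bullet> w"
proof -
  have "tensor_vec (x(i := v)) \<bullet> tensor_vec (y(i := w))
      = (v \<bullet> w) * (\<Prod>j\<in>UNIV - {i}. (x(i := v)) j \<bullet> (y(i := w)) j)"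
    by (simp add: inner_tensor_vec prod.remove[of UNIV i])
  also have "(\<Prod>j\<in>UNIV - {i}. (x(i := v)) j \<bullet> (y(i := w)) j) = 1"
    using assms by (intro prod.neutral) auto
  finally show ?thesis by (simp only: mult_1_right)
qed

lemma tensor_map_in_tensor_space:
  assumes "\<And>i. linear_iso (coord_space (K i)) (T i)" and "z \<in> tensor_space K"
  shows "tensor_map T z \<in> tensor_space K"
proof -
  have lin: "\<And>i. linear (T i)"
    using assms(1) by (simp add: linear_iso_def)
  have T: "T i x \<in> coord_space (K i)" if "x \<in> coord_space (K i)" for i x
    using assms(1) that by (metis linear_iso_def bij_betwE)
  have "subspace (tensor_map T -` tensor_space K)"
    by (rule linear_subspace_vimage[OF linear_tensor_map subspace_tensor_space])
  moreover have "{tensor_vec x |x. \<forall>i. x i \<in> coord_space (K i)} \<subseteq> tensor_map T -` tensor_space K"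
    using T by (auto simp: tensor_map_tensor_vec[OF lin] intro!: tensor_vec_in_tensor_space)
  ultimately have "tensor_space K \<subseteq> tensor_map T -` tensor_space K"
    using span_minimal by (metis (mono_tags, lifting) span_tensor_vec)
  then show ?thesis using assms(2) by blast
qed

lemma tensor_map_inverse:
  assumes "\<And>i. linear (T i)" and "\<And>i. linear (T' i)"
    and inv: "\<And>i x. x \<in> coord_space (K i) \<Longrightarrow> T' i (T i x) = x"
    and "z \<in> tensor_space K"
  shows "tensor_map T' (tensor_map T z) = z"
proof -
  have "linear (tensor_map T' \<circ> tensor_map T)"
    by (intro linear_compose linear_tensor_map)
  then have "(tensor_map T' \<circ> tensor_map T) z = id z"
    by (rule linear_eq_on_tensor_space[OF _ linear_id assms(4)])
      (simp add: tensor_map_tensor_vec assms(1,2) inv)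
  then show ?thesis by simp
qed

lemma inner_tensor_map_tensor_vec:
  assumes "\<And>i. linear (f i)"
    and tr: "\<And>i v. v \<in> coord_space (K i) \<Longrightarrow> f i v \<bullet> x i = v \<bullet> y i"
    and "z \<in> tensor_space K"
  shows "tensor_map f z \<bullet> tensor_vec x = z \<bullet> tensor_vec y"
proof -
  have "linear (\<lambda>z. tensor_map f z \<bullet> tensor_vec x)" "linear (\<lambda>z. z \<bullet> tensor_vec y)"
    by (intro linearI; simp add: linear_add[OF linear_tensor_map]
        linear_scale[OF linear_tensor_map] inner_add_left)+
  then show ?thesis
    by (rule linear_eq_on_tensor_space[OF _ _ assms(3)])
      (simp add: tensor_map_tensor_vec assms(1) inner_tensor_vec tr)
qed

lemma tensor_vec_in_pi_tensor: "(\<And>i. x i \<in> Q i) \<Longrightarrow> tensor_vec x \<in> pi_tensor Q"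
  unfolding pi_tensor_def by (rule hull_inc) blast

lemma pi_tensor_subset:
  assumes "convex C" and "\<And>x. (\<And>i. x i \<in> Q i) \<Longrightarrow> tensor_vec x \<in> C"
  shows "pi_tensor Q \<subseteq> C"
  unfolding pi_tensor_def using assms by (intro hull_minimal) auto

lemma mem_eps_tensor_iff:
  "z \<in> eps_tensor K Q \<longleftrightarrow> z \<in> tensor_space K \<and>
     (\<forall>y. (\<forall>i. y i \<in> polar_set (coord_space (K i)) (Q i)) \<longrightarrow> \<bar>z \<bullet> tensor_vec y\<bar> \<le> 1)"
  (is "_ \<longleftrightarrow> _ \<and> ?bound")
proof -
  let ?P = "\<lambda>i. polar_set (coord_space (K i)) (Q i)"
  have "(\<forall>w\<in>pi_tensor ?P. \<bar>w \<bullet> z\<bar> \<le> 1) \<longleftrightarrow> ?bound"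
  proof
    assume "\<forall>w\<in>pi_tensor ?P. \<bar>w \<bullet> z\<bar> \<le> 1"
    then show ?bound using tensor_vec_in_pi_tensor[of _ ?P] by (auto simp: inner_commute)
  next
    assume bd: ?bound
    have "convex ({w. z \<bullet> w \<le> 1} \<inter> {w. z \<bullet> w \<ge> - 1})"
      by (intro convex_Int convex_halfspace_le convex_halfspace_ge)
    then have "pi_tensor ?P \<subseteq> {w. z \<bullet> w \<le> 1} \<inter> {w. z \<bullet> w \<ge> - 1}"
      by (rule pi_tensor_subset) (use bd in \<open>auto simp: abs_le_iff\<close>)
    then show "\<forall>w\<in>pi_tensor ?P. \<bar>w \<bullet> z\<bar> \<le> 1" by (auto simp: inner_commute abs_le_iff)
  qed
  then show ?thesis by (simp add: eps_tensor_def polar_set_def)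
qed

section \<open>Ellipsoids between the projective and the injective tensor product\<close>

text \<open>
  Both inclusions come from \<open>\<parallel>x\<^sub>1 \<otimes> \<dots> \<otimes> x\<^sub>l\<parallel> = \<parallel>x\<^sub>1\<parallel> \<cdots> \<parallel>x\<^sub>l\<parallel>\<close>. For the second one, the maps
  are moved to the other side of the scalar product, where their transposes send the polar of
  each \<open>Q i\<close> into the unit ball.
\<close>

lemma hilbert_between_pi_eps:
  assumes T: "\<And>i. linear_iso (coord_space (K i)) (T i)"
  defines "Q \<equiv> \<lambda>i. T i ` unit_ball (coord_space (K i))"
  shows "pi_tensor Q \<subseteq> tensor_map T ` unit_ball (tensor_space K)"
    and "tensor_map T ` unit_ball (tensor_space K) \<subseteq> eps_tensor K Q"
proof -
  have lin: "\<And>i. linear (T i)" using T by (simp add: linear_iso_def)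
  have ball: "tensor_vec x \<in> unit_ball (tensor_space K)"
    if "\<And>i. x i \<in> unit_ball (coord_space (K i))" for x
  proof -
    have "(norm (tensor_vec x))\<^sup>2 = (\<Prod>i\<in>UNIV. (norm (x i))\<^sup>2)"
      by (simp add: inner_tensor_vec flip: dot_square_norm)
    also have "\<dots> \<le> 1"
      using that by (intro prod_le_1) (auto simp: unit_ball_def power_le_one)
    finally have "norm (tensor_vec x) \<le> 1" by (simp add: power_le_one_iff)
    then show ?thesis
      using that by (auto simp: unit_ball_def intro!: tensor_vec_in_tensor_space)
  qed
  show "pi_tensor Q \<subseteq> tensor_map T ` unit_ball (tensor_space K)"
  proof (rule pi_tensor_subset)
    show "convex (tensor_map T ` unit_ball (tensor_space K))"
      by (intro convex_linear_image linear_tensor_map convex_unit_ball subspace_tensor_space)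
    fix x assume "\<And>i. x i \<in> Q i"
    then have "\<forall>i. \<exists>b. b \<in> unit_ball (coord_space (K i)) \<and> x i = T i b"
      by (auto simp: Q_def)
    then obtain b where b: "\<And>i. b i \<in> unit_ball (coord_space (K i))" "\<And>i. x i = T i (b i)"
      by metis
    have "tensor_vec x = tensor_map T (tensor_vec b)"
      by (simp add: tensor_map_tensor_vec lin flip: b(2))
    then show "tensor_vec x \<in> tensor_map T ` unit_ball (tensor_space K)"
      using ball b(1) by blast
  qed
  show "tensor_map T ` unit_ball (tensor_space K) \<subseteq> eps_tensor K Q"
  proof
    fix w assume "w \<in> tensor_map T ` unit_ball (tensor_space K)"
    then obtain z where z: "z \<in> unit_ball (tensor_space K)" "w = tensor_map T z" by blast
    then have zW: "z \<in> tensor_space K" by (simp add: unit_ball_def)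
    have "\<bar>w \<bullet> tensor_vec y\<bar> \<le> 1"
      if y: "\<And>i. y i \<in> polar_set (coord_space (K i)) (Q i)" for y
    proof -
      have "\<exists>c. c \<in> coord_space (K i) \<and> (\<forall>v\<in>coord_space (K i). T i v \<bullet> y i = v \<bullet> c)" for i
        using transpose_subspace[OF lin subspace_coord_space] by metis
      then obtain c where c: "\<And>i. c i \<in> coord_space (K i)"
          "\<And>i v. v \<in> coord_space (K i) \<Longrightarrow> T i v \<bullet> y i = v \<bullet> c i"
        by metis
      have "norm (c i) \<le> 1" for i
      proof (cases "c i = 0")
        case False
        have n: "(1 / norm (c i)) *\<^sub>R c i \<in> unit_ball (coord_space (K i))"
          by (intro in_unit_ball_normalize subspace_coord_space c(1))
        then have "\<bar>T i ((1 / norm (c i)) *\<^sub>R c i) \<bullet> y i\<bar> \<le> 1"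
          using y[of i] by (auto simp: polar_set_def Q_def)
        also have "T i ((1 / norm (c i)) *\<^sub>R c i) \<bullet> y i = norm (c i)"
          using n False
          by (subst c(2)) (auto simp: unit_ball_def dot_square_norm power2_eq_square)
        finally show ?thesis by simp
      qed simp
      then have "norm (tensor_vec c) \<le> 1"
        using ball[of c] c(1) by (simp add: unit_ball_def)
      have "\<bar>w \<bullet> tensor_vec y\<bar> = \<bar>z \<bullet> tensor_vec c\<bar>"
        using inner_tensor_map_tensor_vec[OF lin c(2) zW] z(2) by simp
      also have "\<dots> \<le> norm z * norm (tensor_vec c)" by (rule Cauchy_Schwarz_ineq2)
      also have "\<dots> \<le> 1"
        using z(1) \<open>norm (tensor_vec c) \<le> 1\<close> by (intro mult_le_one) (auto simp: unit_ball_def)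
      finally show ?thesis .
    qed
    moreover have "w \<in> tensor_space K"
      using tensor_map_in_tensor_space[OF T zW] z(2) by simp
    ultimately show "w \<in> eps_tensor K Q" by (auto simp: mem_eps_tensor_iff)
  qed
qed

text \<open>
  The rigidity at the heart of the result: with \<open>U\<close> the map that yields \<open>E\<close> in the coordinates
  given by the \<open>T i\<close>, the inverse and the transpose of \<open>U\<close> agree on elementary tensors of unit
  vectors, hence everywhere, and \<open>U\<close> is an isometry.
\<close>

lemma ellipsoid_between_unique:
  assumes T: "\<And>i. linear_iso (coord_space (K i)) (T i)"
    and E: "ellipsoid (tensor_space K) E"
    and pi: "pi_tensor (\<lambda>i. T i ` unit_ball (coord_space (K i))) \<subseteq> E"
    and eps: "E \<subseteq> eps_tensor K (\<lambda>i. T i ` unit_ball (coord_space (K i)))"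
  shows "E = tensor_map T ` unit_ball (tensor_space K)"
proof -
  let ?W = "tensor_space K"
  let ?V = "\<lambda>i. coord_space (K i)"
  have "\<exists>R. linear_iso (?V i) R \<and> (\<forall>x\<in>?V i. R (T i x) = x) \<and> (\<forall>x\<in>?V i. T i (R x) = x)" for i
    using linear_iso_inverse[OF T subspace_coord_space] by metis
  then obtain T' where T': "\<And>i. linear_iso (?V i) (T' i)"
      "\<And>i x. x \<in> ?V i \<Longrightarrow> T' i (T i x) = x" "\<And>i x. x \<in> ?V i \<Longrightarrow> T i (T' i x) = x"
    by metis
  have lin: "\<And>i. linear (T i)" "\<And>i. linear (T' i)"
    using T T'(1) by (auto simp: linear_iso_def)
  have AA': "tensor_map T (tensor_map T' z) = z" "tensor_map T' (tensor_map T z) = z"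
    if "z \<in> ?W" for z
    using that tensor_map_inverse lin T'(2,3) by metis+
  note W = tensor_map_in_tensor_space[OF T] tensor_map_in_tensor_space[OF T'(1)]
  obtain S where S: "linear_iso ?W S" "E = S ` unit_ball ?W"
    using E by (auto simp: ellipsoid_def)
  have SW: "S z \<in> ?W" if "z \<in> ?W" for z
    using S(1) that by (auto simp: linear_iso_def bij_betw_def)
  define U where "U = tensor_map T' \<circ> S"
  have bijA: "bij_betw (tensor_map T') ?W ?W"
    by (rule bij_betw_byWitness[where f' = "tensor_map T"]) (use AA' W in auto)
  have U: "linear_iso ?W U"
    using S(1) bijA linear_tensor_map
    by (auto simp: linear_iso_def U_def intro: linear_compose bij_betw_trans)
  then have linU: "linear U" and UW: "U ` ?W = ?W" by (auto simp: linear_iso_def bij_betw_def)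
  obtain U' where U': "linear_iso ?W U'" "\<And>z. z \<in> ?W \<Longrightarrow> U' (U z) = z"
    using linear_iso_inverse[OF U subspace_tensor_space] by blast
  \<comment> \<open>The inclusion of \<open>\<pi>\<close> puts \<open>b = U' (tensor_vec x)\<close> into the unit ball; the inclusion in \<open>\<epsilon>\<close>
    bounds \<open>\<lambda>z. U z \<bullet> tensor_vec x\<close> by 1 on that ball. The functional has the value 1 at \<open>b\<close>,
    so it is \<open>\<lambda>z. z \<bullet> b\<close>.\<close>
  have unit: "U z \<bullet> tensor_vec x = z \<bullet> U' (tensor_vec x)"
    if x: "\<And>i. x i \<in> ?V i" "\<And>i. norm (x i) = 1" and z: "z \<in> ?W" for x z
  proof -
    have xW: "tensor_vec x \<in> ?W" using x(1) by (rule tensor_vec_in_tensor_space)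
    have "tensor_vec (\<lambda>i. T i (x i)) \<in> E"
      using x by (intro subsetD[OF pi] tensor_vec_in_pi_tensor) (auto simp: unit_ball_def)
    then obtain b where b: "b \<in> unit_ball ?W" "tensor_vec (\<lambda>i. T i (x i)) = S b"
      using S(2) by blast
    then have Ub: "U b = tensor_vec x"
      using AA'(2)[OF xW] by (simp add: U_def tensor_map_tensor_vec lin flip: b(2))
    have "\<exists>y. y \<in> ?V i \<and> (\<forall>v\<in>?V i. T' i v \<bullet> x i = v \<bullet> y)" for i
      using transpose_subspace[OF lin(2) subspace_coord_space] by metis
    then obtain y where y: "\<And>i. y i \<in> ?V i"
        "\<And>i v. v \<in> ?V i \<Longrightarrow> T' i v \<bullet> x i = v \<bullet> y i"
      by metis
    have ypol: "y i \<in> polar_set (?V i) (T i ` unit_ball (?V i))" for i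
    proof -
      have "\<bar>T i v \<bullet> y i\<bar> \<le> 1" if "v \<in> unit_ball (?V i)" for v
      proof -
        have v: "v \<in> ?V i" "norm v \<le> 1" using that by (auto simp: unit_ball_def)
        then have "T i v \<in> ?V i" using T by (metis linear_iso_def bij_betwE)
        then have "\<bar>T i v \<bullet> y i\<bar> = \<bar>v \<bullet> x i\<bar>" using T'(2) v(1) by (simp flip: y(2))
        also have "\<dots> \<le> norm v * norm (x i)" by (rule Cauchy_Schwarz_ineq2)
        finally show ?thesis using v x(2) by simp
      qed
      then show ?thesis using y(1) by (auto simp: polar_set_def)
    qed
    have bound: "\<bar>U z \<bullet> tensor_vec x\<bar> \<le> 1" if "z \<in> unit_ball ?W" for z
    proof -
      have "S z \<in> E" using that S(2) by blast
      then have "S z \<in> ?W" "\<bar>S z \<bullet> tensor_vec y\<bar> \<le> 1"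
        using eps ypol by (auto simp: mem_eps_tensor_iff subset_iff)
      then show ?thesis
        using inner_tensor_map_tensor_vec[where f = T' and K = K, OF lin(2) y(2)] by (simp add: U_def)
    qed
    have "U z \<bullet> tensor_vec x = z \<bullet> b"
    proof (rule functional_attaining_norm[OF _ subspace_tensor_space bound b(1) _ z])
      show "linear (\<lambda>z. U z \<bullet> tensor_vec x)"
        using linU by (intro linearI) (simp_all add: linear_add linear_scale inner_add_left)
      show "U b \<bullet> tensor_vec x = 1"
        unfolding Ub inner_tensor_vec by (simp add: dot_square_norm x(2))
    qed
    moreover have "U' (tensor_vec x) = b"
      using U'(2)[of b] b(1) Ub by (simp add: unit_ball_def)
    ultimately show ?thesis by simp
  qed
  have linU': "linear U'" using U'(1) by (simp add: linear_iso_def)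
  have adj: "U z \<bullet> w = z \<bullet> U' w" if z: "z \<in> ?W" and w: "w \<in> ?W" for z w
  proof -
    have l: "linear (\<lambda>w. U z \<bullet> w)" "linear (\<lambda>w. z \<bullet> U' w)"
      using linU' by (auto intro!: linearI simp: linear_add linear_scale inner_add_right)
    show ?thesis
    proof (rule linear_eq_on_tensor_space[OF l w])
      fix x assume x: "\<And>i. x i \<in> ?V i"
      show "U z \<bullet> tensor_vec x = z \<bullet> U' (tensor_vec x)"
      proof (cases "\<exists>i. x i = 0")
        case True
        then have "tensor_vec x = 0"
          by (auto simp: tensor_vec_def vec_eq_iff intro!: prod_zero)
        then show ?thesis using linU' by (simp add: linear_0)
      next
        case False
        define e where "e i = (1 / norm (x i)) *\<^sub>R x i" for i
        define r where "r = (\<Prod>i\<in>UNIV. norm (x i))"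
        have "x = (\<lambda>i. norm (x i) *\<^sub>R e i)" using False by (auto simp: e_def)
        then have xe: "tensor_vec x = r *\<^sub>R tensor_vec e"
          unfolding r_def by (metis tensor_vec_scaleR)
        have "U z \<bullet> tensor_vec e = z \<bullet> U' (tensor_vec e)"
          by (rule unit[OF _ _ z])
            (use x False in \<open>auto simp: e_def subspace_scale[OF subspace_coord_space]\<close>)
        then show ?thesis by (simp add: xe linear_scale[OF linU'])
      qed
    qed
  qed
  have "norm (U z) = norm z" if "z \<in> ?W" for z
  proof -
    have "U z \<bullet> U z = z \<bullet> z" using adj[of z "U z"] that UW U'(2) by auto
    then show ?thesis by (simp add: norm_eq_sqrt_inner)
  qed
  then have "U ` unit_ball ?W = unit_ball ?W" using U by (intro isometry_unit_ball)
  moreover have "tensor_map T ` U ` unit_ball ?W = S ` unit_ball ?W"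
    using AA'(1) SW by (force simp: U_def unit_ball_def image_image)
  ultimately show ?thesis using S(2) by simp
qed

text \<open>
  Any other choice \<open>T'\<close> of isomorphisms with the same images of the unit balls gives an
  ellipsoid between the same projective and injective tensor products, so uniqueness applies.
\<close>

lemma hilbert_tensor_eq:
  assumes T: "\<And>i. linear_iso (coord_space (K i)) (T i)"
  shows "hilbert_tensor K (\<lambda>i. T i ` unit_ball (coord_space (K i)))
    = tensor_map T ` unit_ball (tensor_space K)"
  unfolding hilbert_tensor_def
proof (rule the_equality)
  let ?W = "tensor_space K"
  let ?B = "\<lambda>i. unit_ball (coord_space (K i))"
  show "\<exists>T'. (\<forall>i. linear_iso (coord_space (K i)) (T' i) \<and> T i ` ?B i = T' i ` ?B i) \<and>
      tensor_map T ` unit_ball ?W = tensor_map T' ` unit_ball ?W"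
    using T by blast
  fix S
  assume "\<exists>T'. (\<forall>i. linear_iso (coord_space (K i)) (T' i) \<and> T i ` ?B i = T' i ` ?B i) \<and>
      S = tensor_map T' ` unit_ball ?W"
  then obtain T' where T': "\<And>i. linear_iso (coord_space (K i)) (T' i)"
      "\<And>i. T i ` ?B i = T' i ` ?B i" "S = tensor_map T' ` unit_ball ?W"
    by blast
  have "linear_iso ?W (tensor_map T')"
  proof -
    have "\<exists>R. linear_iso (coord_space (K i)) R \<and> (\<forall>x\<in>coord_space (K i). R (T' i x) = x) \<and>
        (\<forall>x\<in>coord_space (K i). T' i (R x) = x)" for i
      using linear_iso_inverse[OF T'(1) subspace_coord_space] by metis
    then obtain R where R: "\<And>i. linear_iso (coord_space (K i)) (R i)"
        "\<And>i x. x \<in> coord_space (K i) \<Longrightarrow> R i (T' i x) = x"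
        "\<And>i x. x \<in> coord_space (K i) \<Longrightarrow> T' i (R i x) = x"
      by metis
    have lin: "\<And>i. linear (T' i)" "\<And>i. linear (R i)"
      using T'(1) R(1) by (auto simp: linear_iso_def)
    have "bij_betw (tensor_map T') ?W ?W"
      by (rule bij_betw_byWitness[where f' = "tensor_map R"])
        (use tensor_map_inverse[OF lin R(2)] tensor_map_inverse[OF lin(2,1) R(3)]
          tensor_map_in_tensor_space[OF T'(1)] tensor_map_in_tensor_space[OF R(1)] in auto)
    then show ?thesis by (simp add: linear_iso_def linear_tensor_map)
  qed
  then have "ellipsoid ?W S" using T'(3) by (auto simp: ellipsoid_def)
  then show "S = tensor_map T ` unit_ball ?W"
    using hilbert_between_pi_eps[OF T'(1)] T'(2,3) by (intro ellipsoid_between_unique[OF T]) simp_all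
qed

text \<open>
  Fixing all factors but one embeds the remaining space into the tensor space, and \<open>Q i\<close> is the
  slice of \<open>E\<close> cut out by this embedding. Nonemptiness of the \<open>K i\<close> provides nonzero vectors to
  fix in the other factors.
\<close>

lemma factor_is_ellipsoid:
  assumes K: "\<And>i. K i \<noteq> {}"
    and Q: "\<And>i. symmetric_convex_body (coord_space (K i)) (Q i)"
    and E: "ellipsoid (tensor_space K) E"
    and pi: "pi_tensor Q \<subseteq> E" and eps: "E \<subseteq> eps_tensor K Q"
  shows "ellipsoid (coord_space (K i)) (Q i)"
proof -
  let ?W = "tensor_space K"
  let ?V = "\<lambda>i. coord_space (K i)"
  have QV: "Q j \<subseteq> ?V j" for j using Q[of j] by (simp add: symmetric_convex_body_def)
  have "\<exists>x y. x \<in> Q j \<and> y \<in> polar_set (?V j) (Q j) \<and> x \<bullet> y = 1" for j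
  proof -
    obtain k where "k \<in> K j" using K by blast
    then have "axis k (1::real) \<in> ?V j" by (auto simp: coord_space_def axis_def)
    moreover have "axis k (1::real) \<noteq> 0" by (simp add: axis_eq_0_iff)
    ultimately show ?thesis
      using ex_dual_pair[OF Q subspace_coord_space] by metis
  qed
  then obtain x y where xy: "\<And>j. x j \<in> Q j" "\<And>j. y j \<in> polar_set (?V j) (Q j)"
      "\<And>j. x j \<bullet> y j = 1"
    by metis
  obtain S where S: "linear_iso ?W S" "E = S ` unit_ball ?W"
    using E by (auto simp: ellipsoid_def)
  obtain S' where S': "linear_iso ?W S'" "\<And>z. z \<in> ?W \<Longrightarrow> S' (S z) = z"
      "\<And>z. z \<in> ?W \<Longrightarrow> S (S' z) = z"
    using linear_iso_inverse[OF S(1) subspace_tensor_space] by blast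
  define \<phi> where "\<phi> v = tensor_vec (x(i := v))" for v
  have lin\<phi>: "linear \<phi>" unfolding \<phi>_def by (rule linear_tensor_vec_upd)
  have \<phi>W: "\<phi> v \<in> ?W" if "v \<in> ?V i" for v
    unfolding \<phi>_def using that xy(1) QV by (intro tensor_vec_in_tensor_space) auto
  have E_iff: "\<phi> v \<in> E \<longleftrightarrow> norm (S' (\<phi> v)) \<le> 1" if "v \<in> ?V i" for v
  proof
    assume "\<phi> v \<in> E"
    then obtain b where "b \<in> unit_ball ?W" "\<phi> v = S b" using S(2) by blast
    then show "norm (S' (\<phi> v)) \<le> 1" using S'(2) by (simp add: unit_ball_def)
  next
    assume "norm (S' (\<phi> v)) \<le> 1"
    moreover have "S' (\<phi> v) \<in> ?W"
      using S'(1) \<phi>W[OF that] by (metis linear_iso_def bij_betwE)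
    ultimately show "\<phi> v \<in> E"
      using S(2) S'(3)[OF \<phi>W[OF that]] by (auto simp: unit_ball_def image_iff intro!: bexI[of _ "S' (\<phi> v)"])
  qed
  have Q_iff: "v \<in> Q i \<longleftrightarrow> \<phi> v \<in> E" if v: "v \<in> ?V i" for v
  proof
    assume "v \<in> Q i"
    then show "\<phi> v \<in> E"
      unfolding \<phi>_def using xy(1) by (intro subsetD[OF pi] tensor_vec_in_pi_tensor) auto
  next
    assume \<phi>v: "\<phi> v \<in> E"
    show "v \<in> Q i"
    proof (rule bipolar_subset[OF Q subspace_coord_space v])
      fix w assume "w \<in> polar_set (?V i) (Q i)"
      then have "\<forall>j. (y(i := w)) j \<in> polar_set (?V j) (Q j)" using xy(2) by auto
      then have "\<bar>\<phi> v \<bullet> tensor_vec (y(i := w))\<bar> \<le> 1"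
        using \<phi>v eps mem_eps_tensor_iff by blast
      then show "\<bar>v \<bullet> w\<bar> \<le> 1"
        unfolding \<phi>_def using inner_tensor_vec_upd[where x = x and y = y] xy(3) by metis
    qed
  qed
  define L where "L = S' \<circ> \<phi>"
  have linL: "linear L"
    using lin\<phi> S'(1) by (simp add: L_def linear_iso_def linear_compose)
  have "inj_on L (?V i)"
  proof (rule inj_onI)
    fix v w assume vw: "v \<in> ?V i" "w \<in> ?V i" "L v = L w"
    then have "\<phi> v = \<phi> w" using S'(3) \<phi>W by (metis L_def comp_apply)
    then have "v \<bullet> u = w \<bullet> u" for u
      unfolding \<phi>_def using inner_tensor_vec_upd[where x = x and y = y] xy(3) by metis
    then show "v = w" by (metis vector_eq_rdot)
  qed
  then have "ellipsoid (?V i) {v \<in> ?V i. norm (L v) \<le> 1}"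
    by (intro ellipsoid_preimage_ball linL subspace_coord_space)
  moreover have "{v \<in> ?V i. norm (L v) \<le> 1} = Q i"
    using Q_iff E_iff QV by (auto simp: L_def)
  ultimately show ?thesis by simp
qed

theorem corollary4p3:
  fixes K :: "'l::finite \<Rightarrow> 'n::finite set"
    and E :: "(real ^ ('l \<Rightarrow> 'n)) set"
  assumes "\<And>i. K i \<noteq> {}"
    and "tensorial_ellipsoid K E"
  shows "\<exists>T. (\<forall>i. linear_iso (coord_space (K i)) (T i)) \<and>
             E = tensor_map T ` unit_ball (tensor_space K) \<and>
             tensor_map T ` unit_ball (tensor_space K) =
               hilbert_tensor K (\<lambda>i. T i ` unit_ball (coord_space (K i)))"
proof -
  obtain Q where E: "ellipsoid (tensor_space K) E"
    and Q: "\<And>i. symmetric_convex_body (coord_space (K i)) (Q i)"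
    and between: "pi_tensor Q \<subseteq> E" "E \<subseteq> eps_tensor K Q"
    using assms(2) by (auto simp: tensorial_ellipsoid_def tensorial_body_def)
  have "\<forall>i. \<exists>T. linear_iso (coord_space (K i)) T \<and> Q i = T ` unit_ball (coord_space (K i))"
    using factor_is_ellipsoid[OF assms(1) Q E between] by (auto simp: ellipsoid_def)
  then obtain T where T: "\<And>i. linear_iso (coord_space (K i)) (T i)"
      and QT: "\<And>i. Q i = T i ` unit_ball (coord_space (K i))"
    by metis
  have "Q = (\<lambda>i. T i ` unit_ball (coord_space (K i)))" using QT by blast
  then have "E = tensor_map T ` unit_ball (tensor_space K)"
    using between by (intro ellipsoid_between_unique[OF T E]) simp_all
  moreover have "hilbert_tensor K (\<lambda>i. T i ` unit_ball (coord_space (K i)))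
      = tensor_map T ` unit_ball (tensor_space K)"
    using T by (rule hilbert_tensor_eq)
  ultimately show ?thesis using T by (intro exI[of _ T]) simp
qed

end
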